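(* Let $J$ be a semi-infinite Jacobi matrix with $\|J\|_\infty<\infty$, and let $b$ be the supremum of the absolute values of all negative eigenvalues of all its leading principal submatrices $J^{[N]}$, $N\ge0$. Then for every $s\ge b$ the matrix $J_s=J+sI$ is oscillatory.
   Context: A Jacobi matrix is a real semi-infinite tridiagonal matrix $J=(J_{i,j})_{i,j\ge0}$ with $J_{n,n}=m_n$, $J_{n,n+1}=1$ ($n\ge0$), $J_{n,n-1}=l_n>0$ ($n\ge1$), all other entries zero. $J^{[N]}$ is its leading principal submatrix of size $(N+1)\times(N+1)$ (rows and columns $0,\dots,N$). $\|\cdot\|_\infty$ is the supremum of the absolute row sums. If there are no negative eigenvalues, $b=0$. All eigenvalues of the $J^{[N]}$ are real and $b\le\|J\|_\infty$. A finite matrix is totally nonnegative (TN) if all its minors are nonnegative, and oscillatory if it is TN and some power of it has all minors positive (equivalently, TN, irreducible and nonsingular). A semi-infinite matrix is called oscillatory if all its leading principal submatrices are oscillatory. *)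

theory Defs
  imports
    "HOL-Library.Extended_Nonnegative_Real"
    "Jordan_Normal_Form.Char_Poly"
    "Jordan_Normal_Form.DL_Submatrix"
begin

(* A semi-infinite real matrix is a function nat => nat => real, rows and columns
   indexed from 0. *)

definition jacobi_matrix :: "(nat \<Rightarrow> nat \<Rightarrow> real) \<Rightarrow> bool" where
  "jacobi_matrix J \<longleftrightarrow>
     (\<forall>n. J n (Suc n) = 1) \<and>
     (\<forall>n. J (Suc n) n > 0) \<and>
     (\<forall>i j. j \<noteq> i \<and> j \<noteq> Suc i \<and> i \<noteq> Suc j \<longrightarrow> J i j = 0)"

(* Valued in [0,\<infinity>], so that the finiteness of the norm is a genuine condition. *)
definition norm_inf :: "(nat \<Rightarrow> nat \<Rightarrow> real) \<Rightarrow> ennreal" where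
  "norm_inf J = (SUP i. \<Sum>j. ennreal \<bar>J i j\<bar>)"

(* Size (N + 1) x (N + 1): N is the last row/column index, not the dimension. *)
definition leading_submatrix :: "(nat \<Rightarrow> nat \<Rightarrow> real) \<Rightarrow> nat \<Rightarrow> real mat" where
  "leading_submatrix J N = mat (N + 1) (N + 1) (\<lambda>(i, j). J i j)"

definition shift_matrix :: "(nat \<Rightarrow> nat \<Rightarrow> real) \<Rightarrow> real \<Rightarrow> nat \<Rightarrow> nat \<Rightarrow> real" where
  "shift_matrix J s = (\<lambda>i j. J i j + s * (if i = j then 1 else 0))"

definition negative_eigenvalues :: "(nat \<Rightarrow> nat \<Rightarrow> real) \<Rightarrow> real set" where
  "negative_eigenvalues J = {x. x < 0 \<and> (\<exists>N. eigenvalue (leading_submatrix J N) x)}"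

(* For norm_inf J < \<infinity> the set of absolute values is bounded above (by norm_inf J),
   so the real Sup is the true supremum. *)
definition neg_eigenvalue_bound :: "(nat \<Rightarrow> nat \<Rightarrow> real) \<Rightarrow> real" where
  "neg_eigenvalue_bound J =
     (if negative_eigenvalues J = {} then 0 else (SUP x\<in>negative_eigenvalues J. \<bar>x\<bar>))"

(* The empty minor (I = K = {}) is included in the two definitions below; it equals 1
   and so imposes no condition. *)

definition totally_nonnegative :: "real mat \<Rightarrow> bool" where
  "totally_nonnegative A \<longleftrightarrow>
     (\<forall>I K. I \<subseteq> {..<dim_row A} \<and> K \<subseteq> {..<dim_col A} \<and> card I = card K
        \<longrightarrow> det (submatrix A I K) \<ge> 0)"

definition totally_positive :: "real mat \<Rightarrow> bool" where
  "totally_positive A \<longleftrightarrow>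
     (\<forall>I K. I \<subseteq> {..<dim_row A} \<and> K \<subseteq> {..<dim_col A} \<and> card I = card K
        \<longrightarrow> det (submatrix A I K) > 0)"

(* The power must be a proper one: with k = 0 the 1 x 1 zero matrix would qualify. *)
definition oscillatory :: "real mat \<Rightarrow> bool" where
  "oscillatory A \<longleftrightarrow>
     square_mat A \<and> totally_nonnegative A \<and> (\<exists>k>0. totally_positive (A ^\<^sub>m k))"

definition oscillatory_semi_infinite :: "(nat \<Rightarrow> nat \<Rightarrow> real) \<Rightarrow> bool" where
  "oscillatory_semi_infinite J \<longleftrightarrow> (\<forall>N. oscillatory (leading_submatrix J N))"

end

theory Submission
  imports Defs
begin

text \<open>
  Let \<open>d k\<close> be the leading principal minor of order \<open>k\<close> of \<open>J + s I\<close>, computed by its three-term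
  recurrence. A root \<open>t\<close> of \<open>d (N + 1)\<close>, as a polynomial in \<open>s\<close>, makes \<open>- t\<close> an eigenvalue of the
  truncation \<open>J\<^sup>[\<^sup>N\<^sup>]\<close>, so the monic polynomial \<open>d k\<close> is positive beyond \<open>b\<close>; at \<open>s = b\<close> it is
  nonnegative by continuity, and the recurrence rules out a first zero. Hence every truncation of
  \<open>J + s I\<close> is a product \<open>L U\<close> of nonnegative bidiagonal matrices with positive bands.
  A minor of a bidiagonal matrix is the product of its diagonal entries, so by Cauchy--Binet all
  minors of \<open>L U\<close> are nonnegative, and the minor on rows \<open>f\<close> and columns \<open>g\<close> is positive whenever
  \<open>\<bar>f i - g i\<bar> \<le> 1\<close> for all \<open>i\<close> (pass through the index set \<open>min f g\<close>). By induction the \<open>m\<close>-th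
  power has positive minors whenever \<open>\<bar>f i - g i\<bar> \<le> m\<close>, which is no condition once \<open>m\<close> is the size.
\<close>

section \<open>Minors indexed by sequences\<close>

text \<open>Row and column choices are arbitrary maps, possibly unordered or with repetitions,
  because the expansion behind Cauchy-Binet runs through such minors before they are sorted or
  discarded.\<close>

definition minor :: "'a :: comm_ring_1 mat \<Rightarrow> nat \<Rightarrow> (nat \<Rightarrow> nat) \<Rightarrow> (nat \<Rightarrow> nat) \<Rightarrow> 'a" where
  "minor A k f g = det (mat k k (\<lambda>(i, j). A $$ (f i, g j)))"

text \<open>These sequences stand for the \<open>k\<close>-element subsets of \<open>{..<n}\<close>.
  Unlike sets, they can be compared and combined position by position, as the minimum and clamping
  arguments require.\<close>

definition index_seq :: "nat \<Rightarrow> nat \<Rightarrow> (nat \<Rightarrow> nat) \<Rightarrow> bool" where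
  "index_seq n k f \<longleftrightarrow> (\<forall>i<k. f i < n) \<and> (\<forall>i j. i < j \<and> j < k \<longrightarrow> f i < f j)"

lemma index_seqD:
  assumes "index_seq n k f"
  shows "i < k \<Longrightarrow> f i < n" "i < j \<Longrightarrow> j < k \<Longrightarrow> f i < f j"
  using assms by (auto simp: index_seq_def)

lemma minor_cong:
  assumes "\<And>i j. i < k \<Longrightarrow> j < k \<Longrightarrow> A $$ (f i, g j) = B $$ (f' i, g' j)"
  shows "minor A k f g = minor B k f' g'"
  unfolding minor_def by (rule arg_cong[of _ _ det]) (auto intro!: eq_matI assms)

lemma minor_leibniz:
  "minor A k f g = (\<Sum>p | p permutes {0..<k}. signof p * (\<Prod>i = 0..<k. A $$ (f i, g (p i))))"
proof -
  have "(\<Prod>i = 0..<k. mat k k (\<lambda>(i, j). A $$ (f i, g j)) $$ (i, p i)) =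
      (\<Prod>i = 0..<k. A $$ (f i, g (p i)))" if "p permutes {0..<k}" for p
    using permutes_in_image[OF that] by (intro prod.cong) auto
  then show ?thesis
    unfolding minor_def by (subst det_def'[of _ k]) (auto intro!: sum.cong)
qed

lemma minor_transpose:
  assumes "A \<in> carrier_mat m n" "\<And>i. i < k \<Longrightarrow> f i < n" "\<And>i. i < k \<Longrightarrow> g i < m"
  shows "minor A\<^sup>T k f g = minor A k g f"
proof -
  have "mat k k (\<lambda>(i, j). A\<^sup>T $$ (f i, g j)) = (mat k k (\<lambda>(i, j). A $$ (g i, f j)))\<^sup>T"
    using assms by (auto intro!: eq_matI)
  then show ?thesis
    unfolding minor_def using det_transpose[of _ k] by (metis mat_carrier)
qed

lemma det_submatrix_eq_minor:
  assumes "I \<subseteq> {..<dim_row A}" "K \<subseteq> {..<dim_col A}" "card I = card K"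
  shows "det (submatrix A I K) = minor A (card I) (pick I) (pick K)"
proof -
  have "{i. i < dim_row A \<and> i \<in> I} = I" "{j. j < dim_col A \<and> j \<in> K} = K"
    using assms by auto
  then show ?thesis
    by (simp add: submatrix_def minor_def assms(3))
qed

lemma index_seq_pick:
  assumes "I \<subseteq> {..<n}"
  shows "index_seq n (card I) (pick I)"
  unfolding index_seq_def
  using assms pick_in_set_le[of _ I] pick_mono_le[of _ I] by blast

lemma index_seq_inj_on:
  assumes "index_seq n k f"
  shows "inj_on f {..<k}"
  using index_seqD(2)[OF assms]
  by (intro inj_onI) (metis lessThan_iff linorder_neqE_nat nat_less_le)

lemma index_seq_image:
  assumes "index_seq n k f"
  shows "f ` {..<k} \<subseteq> {..<n}" "card (f ` {..<k}) = k"
  using index_seqD(1)[OF assms] index_seq_inj_on[OF assms] by (auto simp: card_image)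

text \<open>Exactly \<open>i\<close> elements of the image lie below \<open>f i\<close>, and
  \<open>pick\<close> recovers an element of a set from the number of its predecessors.\<close>

lemma pick_image_index_seq:
  assumes f: "index_seq n k f" and "i < k"
  shows "pick (f ` {..<k}) i = f i"
proof -
  have "{a \<in> f ` {..<k}. a < f i} = f ` {..<i}"
  proof -
    have "f j < f i \<longleftrightarrow> j < i" if "j < k" for j
      using index_seqD(2)[OF f, of i j] index_seqD(2)[OF f, of j i] that \<open>i < k\<close>
      by (metis linorder_neqE_nat order.asym)
    then show ?thesis
      using \<open>i < k\<close> by force
  qed
  moreover have "card (f ` {..<i}) = i"
    using inj_on_subset[OF index_seq_inj_on[OF f]] \<open>i < k\<close> by (subst card_image) auto
  ultimately show ?thesis
    using pick_card_in_set[of "f i" "f ` {..<k}"] \<open>i < k\<close> by auto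
qed

text \<open>Identifies the Cauchy-Binet term of the image of \<open>h\<close> with the term written
  in \<open>h\<close> itself.\<close>

lemma minor_pick_image:
  assumes "index_seq n k h"
  shows "minor A k f (pick (h ` {..<k})) = minor A k f h"
    and "minor A k (pick (h ` {..<k})) f = minor A k h f"
  using pick_image_index_seq[OF assms] by (auto intro!: minor_cong)

subsection \<open>The Cauchy--Binet formula\<close>

lemma minor_permute_rows:
  assumes "p permutes {0..<k}"
  shows "minor A k (f \<circ> p) g = signof p * minor A k f g"
proof -
  let ?M = "mat k k (\<lambda>(i, j). A $$ (f i, g j))"
  have "mat k k (\<lambda>(i, j). ?M $$ (p i, j)) = mat k k (\<lambda>(i, j). A $$ ((f \<circ> p) i, g j))"
  proof (rule eq_matI)
    fix i j
    assume "i < dim_row (mat k k (\<lambda>(i, j). A $$ ((f \<circ> p) i, g j)))"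
      "j < dim_col (mat k k (\<lambda>(i, j). A $$ ((f \<circ> p) i, g j)))"
    moreover from this have "p i < k"
      using permutes_in_image[OF assms, of i] by simp
    ultimately show "mat k k (\<lambda>(i, j). ?M $$ (p i, j)) $$ (i, j) =
        mat k k (\<lambda>(i, j). A $$ ((f \<circ> p) i, g j)) $$ (i, j)" by simp
  qed simp_all
  then show ?thesis
    unfolding minor_def using det_permute_rows[OF _ assms, of ?M] by simp
qed

lemma minor_not_inj:
  assumes "\<not> inj_on f {0..<k}"
  shows "minor A k f g = 0"
proof -
  obtain i j where "i < k" "j < k" "i \<noteq> j" "f i = f j"
    using assms by (auto simp: inj_on_def)
  then show ?thesis
    unfolding minor_def by (intro det_identical_rows[of _ k i j]) (auto intro!: eq_vecI)
qed

text \<open>An injection into a set of the same finite size is a bijection, so it factors uniquely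
  as a permutation followed by the increasing enumeration \<open>pick S\<close>. The restriction
  makes the maps extensional, as the function space demands.\<close>

lemma bij_betw_permutes_pick:
  assumes "finite S" "card S = k"
  shows "bij_betw (\<lambda>p. restrict (pick S \<circ> p) {0..<k}) {p. p permutes {0..<k}}
    {h \<in> {0..<k} \<rightarrow>\<^sub>E S. inj_on h {0..<k}}"
proof -
  have bij: "bij_betw (pick S) {0..<k} S"
  proof -
    have "inj_on (pick S) {0..<k}"
      using pick_mono_le[of _ S] assms
      by (intro inj_onI) (metis atLeastLessThan_iff linorder_neqE_nat nat_less_le)
    moreover from this have "pick S ` {0..<k} = S"
      using pick_in_set_le[of _ S] assms by (intro card_subset_eq) (auto simp: card_image)
    ultimately show ?thesis by (simp add: bij_betw_def)
  qed
  show ?thesis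
  proof (intro bij_betwI')
    fix p q assume pq: "p \<in> {p. p permutes {0..<k}}" "q \<in> {p. p permutes {0..<k}}"
    show "restrict (pick S \<circ> p) {0..<k} = restrict (pick S \<circ> q) {0..<k} \<longleftrightarrow> p = q"
    proof
      assume eq: "restrict (pick S \<circ> p) {0..<k} = restrict (pick S \<circ> q) {0..<k}"
      show "p = q"
      proof
        fix i
        show "p i = q i"
        proof (cases "i \<in> {0..<k}")
          case True
          then have "pick S (p i) = pick S (q i)"
            using fun_cong[OF eq, of i] by simp
          moreover have "p i \<in> {0..<k}" "q i \<in> {0..<k}"
            using pq True by (simp_all only: mem_Collect_eq permutes_in_image)
          ultimately show ?thesis
            using bij by (auto simp: bij_betw_def dest: inj_onD)
        next
          case False
          then show ?thesis using pq by (auto simp: permutes_def)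
        qed
      qed
    qed auto
  next
    fix p assume "p \<in> {p. p permutes {0..<k}}"
    then have p: "bij_betw p {0..<k} {0..<k}"
      by (simp add: permutes_imp_bij)
    then have "bij_betw (pick S \<circ> p) {0..<k} S"
      using bij by (rule bij_betw_trans)
    then show "restrict (pick S \<circ> p) {0..<k} \<in> {h \<in> {0..<k} \<rightarrow>\<^sub>E S. inj_on h {0..<k}}"
      by (auto simp: bij_betw_def inj_on_def)
  next
    fix h assume "h \<in> {h \<in> {0..<k} \<rightarrow>\<^sub>E S. inj_on h {0..<k}}"
    then have h: "h \<in> {0..<k} \<rightarrow>\<^sub>E S" "inj_on h {0..<k}" by auto
    have "h ` {0..<k} = S"
      using h assms by (intro card_subset_eq) (auto simp: card_image)
    then have hb: "bij_betw h {0..<k} S"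
      using h by (simp add: bij_betw_def)
    define q where "q = inv_into {0..<k} (pick S)"
    define p where "p i = (if i \<in> {0..<k} then q (h i) else i)" for i
    have "bij_betw (q \<circ> h) {0..<k} {0..<k}"
      unfolding q_def using hb bij_betw_inv_into[OF bij] by (rule bij_betw_trans)
    then have "bij_betw p {0..<k} {0..<k}"
      by (rule bij_betw_cong[THEN iffD1, rotated]) (simp add: p_def)
    then have "p permutes {0..<k}"
      by (rule bij_imp_permutes) (simp add: p_def)
    moreover have "h = restrict (pick S \<circ> p) {0..<k}"
    proof
      fix i
      show "h i = restrict (pick S \<circ> p) {0..<k} i"
      proof (cases "i \<in> {0..<k}")
        case True
        then have "h i \<in> S" using h by auto
        then show ?thesis
          using True bij_betw_inv_into_right[OF bij] by (simp add: p_def q_def)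
      next
        case False
        then show ?thesis using h(1) by (auto simp: PiE_def extensional_def)
      qed
    qed
    ultimately show "\<exists>p \<in> {p. p permutes {0..<k}}. h = restrict (pick S \<circ> p) {0..<k}"
      by blast
  qed
qed

text \<open>Expanding the entries of the product gives a sum over all maps \<open>h\<close> from row
  positions to intermediate indices. Non-injective maps contribute zero; the others are grouped by
  their image \<open>S\<close>, where sorting \<open>h\<close> produces the signs of the Leibniz
  formula for the minor of \<open>A\<close>.\<close>

theorem cauchy_binet:
  fixes A B :: "'a :: comm_ring_1 mat"
  assumes A: "A \<in> carrier_mat m n" and B: "B \<in> carrier_mat n l"
    and f: "\<And>i. i < k \<Longrightarrow> f i < m" and g: "\<And>i. i < k \<Longrightarrow> g i < l"
  shows "minor (A * B) k f g =
    (\<Sum>S | S \<subseteq> {..<n} \<and> card S = k. minor A k f (pick S) * minor B k (pick S) g)"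
proof -
  let ?K = "{0..<k}"
  let ?P = "{p. p permutes ?K}"
  let ?H = "?K \<rightarrow>\<^sub>E {0..<n}"
  let ?inj = "{h \<in> ?H. inj_on h ?K}"
  let ?SS = "{S. S \<subseteq> {..<n} \<and> card S = k}"
  define a where "a h = (\<Prod>i\<in>?K. A $$ (f i, h i))" for h
  have finH: "finite ?H" by (intro finite_PiE) auto
  have "minor (A * B) k f g =
      (\<Sum>p\<in>?P. signof p * (\<Prod>i\<in>?K. \<Sum>c\<in>{0..<n}. A $$ (f i, c) * B $$ (c, g (p i))))"
    unfolding minor_leibniz
  proof (intro sum.cong refl arg_cong2[of _ _ _ _ "(*)"] prod.cong)
    fix p i assume p: "p \<in> ?P" and i: "i \<in> ?K"
    then have "p i < k" using permutes_in_image[of p ?K i] by simp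
    then show "(A * B) $$ (f i, g (p i)) = (\<Sum>c\<in>{0..<n}. A $$ (f i, c) * B $$ (c, g (p i)))"
      using A B f[of i] g[of "p i"] i by (simp add: scalar_prod_def)
  qed
  \<comment> \<open>Distributing the product over the inner sums chooses one intermediate index
    \<open>h i\<close> for each row.\<close>
  also have "\<dots> = (\<Sum>p\<in>?P. signof p * (\<Sum>h\<in>?H. \<Prod>i\<in>?K. A $$ (f i, h i) * B $$ (h i, g (p i))))"
    by (subst prod_sum_PiE) auto
  also have "\<dots> = (\<Sum>p\<in>?P. \<Sum>h\<in>?H. a h * (signof p * (\<Prod>i\<in>?K. B $$ (h i, g (p i)))))"
    by (simp add: sum_distrib_left prod.distrib a_def mult_ac)
  also have "\<dots> = (\<Sum>h\<in>?H. a h * minor B k h g)"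
    unfolding minor_leibniz by (subst sum.swap) (simp add: sum_distrib_left)
  also have "\<dots> = (\<Sum>h\<in>?inj. a h * minor B k h g)"
    using finH minor_not_inj[of _ k B g] by (intro sum.mono_neutral_right) auto
  also have "\<dots> = (\<Sum>S\<in>?SS. \<Sum>h\<in>{h \<in> ?inj. h ` ?K = S}. a h * minor B k h g)"
  proof (rule sum.group[symmetric])
    show "finite ?inj" using finH by (rule finite_subset[rotated]) blast
  qed (auto simp: card_image PiE_iff)
  also have "\<dots> = (\<Sum>S\<in>?SS. minor A k f (pick S) * minor B k (pick S) g)"
  proof (intro sum.cong refl)
    fix S assume "S \<in> ?SS"
    then have S: "S \<subseteq> {..<n}" "card S = k" by auto
    then have "finite S" using finite_subset by blast
    have "{h \<in> ?inj. h ` ?K = S} = {h \<in> ?K \<rightarrow>\<^sub>E S. inj_on h ?K}"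
    proof (intro equalityI subsetI)
      fix h assume h: "h \<in> {h \<in> ?K \<rightarrow>\<^sub>E S. inj_on h ?K}"
      then have "h ` ?K = S"
        using S \<open>finite S\<close> by (intro card_subset_eq) (auto simp: card_image)
      moreover have "h \<in> ?H"
        using h S PiE_mono[of ?K "\<lambda>_. S" "\<lambda>_. {0..<n}"] by (auto simp: lessThan_atLeast0)
      ultimately show "h \<in> {h \<in> ?inj. h ` ?K = S}"
        using h by simp
    qed (auto simp: PiE_iff)
    then have "(\<Sum>h\<in>{h \<in> ?inj. h ` ?K = S}. a h * minor B k h g) =
        (\<Sum>h\<in>{h \<in> ?K \<rightarrow>\<^sub>E S. inj_on h ?K}. a h * minor B k h g)" by simp
    also have "\<dots> = (\<Sum>p\<in>?P. a (restrict (pick S \<circ> p) ?K) * minor B k (restrict (pick S \<circ> p) ?K) g)"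
      by (rule sum.reindex_bij_betw[OF bij_betw_permutes_pick, symmetric]) fact+
    \<comment> \<open>Sorting the rows of the minor of \<open>B\<close> costs the sign of
      \<open>p\<close>, which completes the Leibniz term of the minor of \<open>A\<close>.\<close>
    also have "\<dots> = (\<Sum>p\<in>?P. (signof p * (\<Prod>i\<in>?K. A $$ (f i, pick S (p i)))) * minor B k (pick S) g)"
    proof (intro sum.cong refl)
      fix p assume "p \<in> ?P"
      then have "minor B k (restrict (pick S \<circ> p) ?K) g = signof p * minor B k (pick S) g"
        by (subst minor_permute_rows[symmetric]) (auto intro!: minor_cong)
      then show "a (restrict (pick S \<circ> p) ?K) * minor B k (restrict (pick S \<circ> p) ?K) g =
          (signof p * (\<Prod>i\<in>?K. A $$ (f i, pick S (p i)))) * minor B k (pick S) g"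
        by (simp add: a_def mult_ac)
    qed
    also have "\<dots> = minor A k f (pick S) * minor B k (pick S) g"
      by (simp add: minor_leibniz[of A] sum_distrib_right)
    finally show "(\<Sum>h\<in>{h \<in> ?inj. h ` ?K = S}. a h * minor B k h g) =
        minor A k f (pick S) * minor B k (pick S) g" .
  qed
  finally show ?thesis .
qed

subsection \<open>Minors of products of bidiagonal matrices\<close>

text \<open>Strict increase gives \<open>i \<le> p i\<close> by induction, and a permutation of an
  initial segment that never decreases an index is the identity.\<close>

lemma strict_mono_permutes_id:
  fixes p :: "nat \<Rightarrow> nat"
  assumes p: "p permutes {0..<k}" and mono: "\<And>i j. i < j \<Longrightarrow> j < k \<Longrightarrow> p i < p j"
  shows "p = id"
proof (rule permutes_natset_ge[OF p], rule ballI)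
  fix i assume "i \<in> {0..<k}"
  then have "i < k" by simp
  then show "i \<le> p i"
  proof (induction i)
    case (Suc i)
    then show ?case using mono[of i "Suc i"] by simp
  qed simp
qed

text \<open>For a nonvanishing Leibniz term, \<open>i < j\<close> forces \<open>g (p i) \<le> f i + 1 \<le> f j \<le> g (p j)\<close>,
  so only the identity permutation contributes.\<close>

lemma minor_upper_bidiagonal:
  assumes zero: "\<And>i j. i < n \<Longrightarrow> j < n \<Longrightarrow> j \<noteq> i \<Longrightarrow> j \<noteq> Suc i \<Longrightarrow> U $$ (i, j) = 0"
    and f: "index_seq n k f" and g: "index_seq n k g"
  shows "minor U k f g = (\<Prod>i = 0..<k. U $$ (f i, g i))"
proof -
  have "(\<Prod>i = 0..<k. U $$ (f i, g (p i))) = 0" if p: "p permutes {0..<k}" and "p \<noteq> id" for p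
  proof (rule ccontr)
    assume nz: "(\<Prod>i = 0..<k. U $$ (f i, g (p i))) \<noteq> 0"
    have pk: "p i < k" if "i < k" for i
      using permutes_in_image[OF p, of i] that by simp
    have fg: "f i \<le> g (p i) \<and> g (p i) \<le> Suc (f i)" if "i < k" for i
    proof -
      have "U $$ (f i, g (p i)) \<noteq> 0"
        using nz that by (metis (no_types, lifting) atLeastLessThan_iff finite_atLeastLessThan le0 prod_zero)
      then have "g (p i) = f i \<or> g (p i) = Suc (f i)"
        using zero[of "f i" "g (p i)"] index_seqD(1)[OF f that] index_seqD(1)[OF g pk[OF that]] by blast
      then show ?thesis by auto
    qed
    have "p i < p j" if "i < j" "j < k" for i j
    proof (rule ccontr)
      assume "\<not> p i < p j"
      moreover have "p i \<noteq> p j"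
        using permutes_inj[OF p] \<open>i < j\<close> by (auto dest: injD)
      ultimately have "g (p j) < g (p i)"
        using index_seqD(2)[OF g] pk that by simp
      then show False
        using fg[of i] fg[of j] index_seqD(2)[OF f that] that by linarith
    qed
    then show False
      using strict_mono_permutes_id[OF p] \<open>p \<noteq> id\<close> by blast
  qed
  then have "minor U k f g = (\<Sum>p\<in>{id}. signof p * (\<Prod>i = 0..<k. U $$ (f i, g (p i))))"
    unfolding minor_leibniz
    by (intro sum.mono_neutral_right) (auto simp: finite_permutations permutes_id)
  then show ?thesis by simp
qed

text \<open>Each Cauchy-Binet term is a product of nonnegative entries, so nothing cancels and a
  single positive term makes the whole minor positive.\<close>

lemma minor_bidiagonal_product:
  fixes L U :: "real mat"
  assumes L: "L \<in> carrier_mat n n" and U: "U \<in> carrier_mat n n"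
    and L0: "\<And>i j. i < n \<Longrightarrow> j < n \<Longrightarrow> i \<noteq> j \<Longrightarrow> i \<noteq> Suc j \<Longrightarrow> L $$ (i, j) = 0"
    and Lpos: "\<And>i j. i < n \<Longrightarrow> j < n \<Longrightarrow> i = j \<or> i = Suc j \<Longrightarrow> L $$ (i, j) > 0"
    and U0: "\<And>i j. i < n \<Longrightarrow> j < n \<Longrightarrow> j \<noteq> i \<Longrightarrow> j \<noteq> Suc i \<Longrightarrow> U $$ (i, j) = 0"
    and Upos: "\<And>i j. i < n \<Longrightarrow> j < n \<Longrightarrow> j = i \<or> j = Suc i \<Longrightarrow> U $$ (i, j) > 0"
    and f: "index_seq n k f" and g: "index_seq n k g"
  shows "minor (L * U) k f g \<ge> 0"
    and "(\<And>i. i < k \<Longrightarrow> f i \<le> Suc (g i) \<and> g i \<le> Suc (f i)) \<Longrightarrow> minor (L * U) k f g > 0"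
proof -
  let ?SS = "{S. S \<subseteq> {..<n} \<and> card S = k}"
  have Ueq: "minor U k f g = (\<Prod>i = 0..<k. U $$ (f i, g i))"
    if "index_seq n k f" "index_seq n k g" for f g
    by (rule minor_upper_bidiagonal[OF U0 that])
  have Leq: "minor L k f g = (\<Prod>i = 0..<k. L $$ (f i, g i))"
    if f: "index_seq n k f" and g: "index_seq n k g" for f g
  proof -
    \<comment> \<open>Transposition turns \<open>L\<close> into an upper bidiagonal matrix and
      exchanges the two sequences.\<close>
    have "minor L k f g = minor L\<^sup>T k g f"
      by (rule minor_transpose[OF L, symmetric]) (use index_seqD(1) f g in blast)+
    also have "\<dots> = (\<Prod>i = 0..<k. L\<^sup>T $$ (g i, f i))"
      using L0 L by (intro minor_upper_bidiagonal[OF _ g f]) auto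
    also have "\<dots> = (\<Prod>i = 0..<k. L $$ (f i, g i))"
      using L index_seqD(1)[OF f] index_seqD(1)[OF g] by (intro prod.cong) auto
    finally show ?thesis .
  qed
  have Lnn: "L $$ (i, j) \<ge> 0" and Unn: "U $$ (i, j) \<ge> 0" if "i < n" "j < n" for i j
    using L0[OF that] Lpos[OF that] U0[OF that] Upos[OF that] by fastforce+
  have Lminor: "minor L k f g \<ge> 0" and Uminor: "minor U k f g \<ge> 0"
    if fg: "index_seq n k f" "index_seq n k g" for f g
    unfolding Leq[OF fg] Ueq[OF fg]
    using index_seqD(1)[OF fg(1)] index_seqD(1)[OF fg(2)]
    by (auto intro!: prod_nonneg Lnn Unn)
  have cb: "minor (L * U) k f g = (\<Sum>S\<in>?SS. minor L k f (pick S) * minor U k (pick S) g)"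
    by (rule cauchy_binet[OF L U]) (use index_seqD(1) f g in blast)+
  have pick: "index_seq n k (pick S)" if "S \<in> ?SS" for S
    using that index_seq_pick by auto
  have nonneg: "minor L k f (pick S) * minor U k (pick S) g \<ge> 0" if "S \<in> ?SS" for S
    using Lminor Uminor f g pick[OF that] by simp
  then show "minor (L * U) k f g \<ge> 0"
    unfolding cb by (rule sum_nonneg)
  assume close: "\<And>i. i < k \<Longrightarrow> f i \<le> Suc (g i) \<and> g i \<le> Suc (f i)"
  \<comment> \<open>\<open>L\<close> leads from an index to itself or its predecessor,
    \<open>U\<close> from an index to itself or its successor. When \<open>f i\<close> and
    \<open>g i\<close> differ by at most 1, both steps of the path from \<open>f i\<close> through
    their minimum to \<open>g i\<close> hit positive entries.\<close>
  define h where "h i = min (f i) (g i)" for i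
  have h: "index_seq n k h"
    unfolding index_seq_def h_def
    using index_seqD(1)[OF f] index_seqD(2)[OF f] index_seqD(2)[OF g]
    by (auto simp: min_less_iff_conj min_less_iff_disj)
  have hn: "f i < n" "g i < n" "h i < n" if "i < k" for i
    using that index_seqD(1) f g h by blast+
  have "minor L k f h > 0"
    unfolding Leq[OF f h] using close hn
    by (intro prod_pos) (force intro!: Lpos simp: h_def min_def)
  moreover have "minor U k h g > 0"
    unfolding Ueq[OF h g] using close hn
    by (intro prod_pos) (force intro!: Upos simp: h_def min_def)
  ultimately have "minor L k f (pick (h ` {..<k})) * minor U k (pick (h ` {..<k})) g > 0"
    by (simp add: minor_pick_image[OF h])
  moreover have "h ` {..<k} \<in> ?SS"
    using index_seq_image[OF h] by simp
  ultimately show "minor (L * U) k f g > 0"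
    unfolding cb using nonneg by (intro sum_pos2) (auto intro: finite_subset[of _ "Pow {..<n}"])
qed

subsection \<open>Powers of matrices with positive minors near the diagonal\<close>

text \<open>All Cauchy-Binet terms are nonnegative, so one intermediate sequence \<open>h\<close>
  with both factors positive suffices.\<close>

lemma minor_mult_pos:
  fixes A B :: "real mat"
  assumes A: "A \<in> carrier_mat n n" and B: "B \<in> carrier_mat n n"
    and Ann: "\<And>f g. index_seq n k f \<Longrightarrow> index_seq n k g \<Longrightarrow> minor A k f g \<ge> 0"
    and Bnn: "\<And>f g. index_seq n k f \<Longrightarrow> index_seq n k g \<Longrightarrow> minor B k f g \<ge> 0"
    and f: "index_seq n k f" and g: "index_seq n k g"
  shows "minor (A * B) k f g \<ge> 0"
    and "index_seq n k h \<Longrightarrow> minor A k f h > 0 \<Longrightarrow> minor B k h g > 0 \<Longrightarrow> minor (A * B) k f g > 0"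
proof -
  let ?SS = "{S. S \<subseteq> {..<n} \<and> card S = k}"
  have cb: "minor (A * B) k f g = (\<Sum>S\<in>?SS. minor A k f (pick S) * minor B k (pick S) g)"
    by (rule cauchy_binet[OF A B]) (use index_seqD(1) f g in blast)+
  have nonneg: "minor A k f (pick S) * minor B k (pick S) g \<ge> 0" if "S \<in> ?SS" for S
    using Ann Bnn f g index_seq_pick[of S n] that by auto
  then show "minor (A * B) k f g \<ge> 0"
    unfolding cb by (rule sum_nonneg)
  assume h: "index_seq n k h" and "minor A k f h > 0" "minor B k h g > 0"
  then have "minor A k f (pick (h ` {..<k})) * minor B k (pick (h ` {..<k})) g > 0"
    by (simp add: minor_pick_image[OF h])
  moreover have "h ` {..<k} \<in> ?SS"
    using index_seq_image[OF h] by simp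
  ultimately show "minor (A * B) k f g > 0"
    unfolding cb using nonneg by (intro sum_pos2) (auto intro: finite_subset[of _ "Pow {..<n}"])
qed


text \<open>Induction on \<open>m\<close>: each further factor \<open>A\<close> extends the reach of
  the positive minors by one. For sequences at distance at most \<open>m + 1\<close>, the
  intermediate sequence of the product is found within \<open>m\<close> of \<open>f\<close> and
  within 1 of \<open>g\<close>.\<close>

lemma minor_pow:
  fixes A :: "real mat"
  assumes A: "A \<in> carrier_mat n n"
    and nonneg: "\<And>f g. index_seq n k f \<Longrightarrow> index_seq n k g \<Longrightarrow> minor A k f g \<ge> 0"
    and pos: "\<And>f g. index_seq n k f \<Longrightarrow> index_seq n k g \<Longrightarrow>
      (\<And>i. i < k \<Longrightarrow> f i \<le> Suc (g i) \<and> g i \<le> Suc (f i)) \<Longrightarrow> minor A k f g > 0"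
    and f: "index_seq n k f" and g: "index_seq n k g"
  shows "minor (A ^\<^sub>m m) k f g \<ge> 0"
    and "(\<And>i. i < k \<Longrightarrow> f i \<le> g i + m \<and> g i \<le> f i + m) \<Longrightarrow> minor (A ^\<^sub>m m) k f g > 0"
proof -
  \<comment> \<open>The identity matrix is upper bidiagonal with zero superdiagonal; this settles
    the zeroth power.\<close>
  have one: "minor (1\<^sub>m n :: real mat) k f g = (\<Prod>i = 0..<k. 1\<^sub>m n $$ (f i, g i))"
    if "index_seq n k f" "index_seq n k g" for f g
    using that by (rule minor_upper_bidiagonal[rotated]) auto
  have *: "minor (A ^\<^sub>m m) k f g \<ge> 0 \<and>
      ((\<forall>i<k. f i \<le> g i + m \<and> g i \<le> f i + m) \<longrightarrow> minor (A ^\<^sub>m m) k f g > 0)"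
    using f g
  proof (induction m arbitrary: f g)
    case 0
    have "1\<^sub>m n $$ (f i, g i) \<ge> (0 :: real)" if "i < k" for i
      using index_seqD(1)[OF 0(1) that] index_seqD(1)[OF 0(2) that] by simp
    moreover have "1\<^sub>m n $$ (f i, g i) = (1 :: real)" if "i < k" "f i = g i" for i
      using index_seqD(1)[OF 0(2) \<open>i < k\<close>] that by simp
    ultimately show ?case
      using A by (auto simp: one[OF 0] intro!: prod_nonneg prod_pos)
  next
    case (Suc m)
    have Am: "A ^\<^sub>m m \<in> carrier_mat n n" using A by simp
    have Amnn: "minor (A ^\<^sub>m m) k f g \<ge> 0" if "index_seq n k f" "index_seq n k g" for f g
      using Suc.IH[OF that] by blast
    have "minor (A ^\<^sub>m m * A) k f g > 0" if close: "\<forall>i<k. f i \<le> g i + Suc m \<and> g i \<le> f i + Suc m"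
    proof -
      \<comment> \<open>\<open>f\<close> clamped to distance at most 1 from \<open>g\<close>\<close>
      define h where "h i = min (Suc (g i)) (max (g i - 1) (f i))" for i
      have "h i < n" if "i < k" for i
        using index_seqD(1)[OF Suc.prems(1) that] index_seqD(1)[OF Suc.prems(2) that]
        by (simp add: h_def)
      \<comment> \<open>Minimum and maximum preserve strict increase. Truncation of
        \<open>g i - 1\<close> at 0 is harmless: the maximum with \<open>f i \<ge> 0\<close> is the
        same as for integer subtraction.\<close>
      moreover have "h i < h j" if "i < j" "j < k" for i j
        using index_seqD(2)[OF Suc.prems(1) that] index_seqD(2)[OF Suc.prems(2) that]
        by (auto simp: h_def min_def max_def)
      ultimately have h: "index_seq n k h"
        by (simp add: index_seq_def)
      \<comment> \<open>Either \<open>h i = f i\<close>, or \<open>h i\<close> lies one step from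
        \<open>g i\<close> towards \<open>f i\<close>, which shortens the distance to
        \<open>f i\<close> by one.\<close>
      have "f i \<le> h i + m \<and> h i \<le> f i + m" "h i \<le> Suc (g i) \<and> g i \<le> Suc (h i)" if "i < k" for i
        using close[rule_format, OF that] by (auto simp: h_def min_def max_def)
      then show ?thesis
        using Suc.IH[OF Suc.prems(1) h] pos[OF h Suc.prems(2)]
        by (intro minor_mult_pos(2)[OF Am A _ _ Suc.prems h]) (auto intro: Amnn nonneg)
    qed
    moreover have "minor (A ^\<^sub>m m * A) k f g \<ge> 0"
      by (intro minor_mult_pos(1)[OF Am A _ _ Suc.prems]) (auto intro: Amnn nonneg)
    ultimately show ?case by simp
  qed
  then show "minor (A ^\<^sub>m m) k f g \<ge> 0" by blast
  show "minor (A ^\<^sub>m m) k f g > 0" if "\<And>i. i < k \<Longrightarrow> f i \<le> g i + m \<and> g i \<le> f i + m"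
    using * that by blast
qed

lemma oscillatory_bidiagonal_product:
  fixes L U :: "real mat"
  assumes "n > 0" and L: "L \<in> carrier_mat n n" and U: "U \<in> carrier_mat n n"
    and L0: "\<And>i j. i < n \<Longrightarrow> j < n \<Longrightarrow> i \<noteq> j \<Longrightarrow> i \<noteq> Suc j \<Longrightarrow> L $$ (i, j) = 0"
    and Lpos: "\<And>i j. i < n \<Longrightarrow> j < n \<Longrightarrow> i = j \<or> i = Suc j \<Longrightarrow> L $$ (i, j) > 0"
    and U0: "\<And>i j. i < n \<Longrightarrow> j < n \<Longrightarrow> j \<noteq> i \<Longrightarrow> j \<noteq> Suc i \<Longrightarrow> U $$ (i, j) = 0"
    and Upos: "\<And>i j. i < n \<Longrightarrow> j < n \<Longrightarrow> j = i \<or> j = Suc i \<Longrightarrow> U $$ (i, j) > 0"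
  shows "oscillatory (L * U)"
proof -
  have LU: "L * U \<in> carrier_mat n n" using L U by simp
  have nonneg: "minor (L * U) k f g \<ge> 0" if "index_seq n k f" "index_seq n k g" for k f g
    by (rule minor_bidiagonal_product(1)[OF L U _ _ _ _ that]; (rule L0 Lpos U0 Upos; assumption)?)
  have pos: "minor (L * U) k f g > 0" if "index_seq n k f" "index_seq n k g"
    "\<And>i. i < k \<Longrightarrow> f i \<le> Suc (g i) \<and> g i \<le> Suc (f i)" for k f g
    by (rule minor_bidiagonal_product(2)[OF L U _ _ _ _ that(1,2)];
        (rule L0 Lpos U0 Upos that(3); assumption)?)
  have "det (submatrix (L * U) I K) \<ge> 0"
    if "I \<subseteq> {..<n}" "K \<subseteq> {..<n}" "card I = card K" for I K
  proof -
    have "det (submatrix (L * U) I K) = minor (L * U) (card I) (pick I) (pick K)"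
      using that by (intro det_submatrix_eq_minor) (simp_all add: carrier_matD[OF LU] del: index_mult_mat)
    then show ?thesis
      using nonneg[OF index_seq_pick[OF that(1)]] index_seq_pick[OF that(2)] that(3) by simp
  qed
  then have "totally_nonnegative (L * U)"
    using L U by (auto simp: totally_nonnegative_def)
  \<comment> \<open>Two indices below \<open>n\<close> differ by less than \<open>n\<close>, so at
    exponent \<open>n\<close> the distance condition holds for all pairs of sequences.\<close>
  moreover have "det (submatrix ((L * U) ^\<^sub>m n) I K) > 0"
    if "I \<subseteq> {..<n}" "K \<subseteq> {..<n}" "card I = card K" for I K
  proof -
    have I: "index_seq n (card I) (pick I)" and K: "index_seq n (card I) (pick K)"
      using index_seq_pick[OF that(1)] index_seq_pick[OF that(2)] that(3) by simp_all
    have "minor ((L * U) ^\<^sub>m n) (card I) (pick I) (pick K) > 0"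
    proof (rule minor_pow(2)[OF LU _ _ I K])
      show "minor (L * U) (card I) f g > 0" if "index_seq n (card I) f" "index_seq n (card I) g"
        "\<And>i. i < card I \<Longrightarrow> f i \<le> Suc (g i) \<and> g i \<le> Suc (f i)" for f g
        using that by (intro pos) auto
      show "pick I i \<le> pick K i + n \<and> pick K i \<le> pick I i + n" if "i < card I" for i
        using index_seqD(1)[OF I that] index_seqD(1)[OF K that] by simp
    qed (rule nonneg)
    moreover have "dim_row ((L * U) ^\<^sub>m n) = n" "dim_col ((L * U) ^\<^sub>m n) = n"
      using carrier_matD[OF pow_carrier_mat[OF LU, of n]] by simp_all
    ultimately show ?thesis
      using that det_submatrix_eq_minor[of I "(L * U) ^\<^sub>m n" K] by (simp only:)
  qed
  then have "totally_positive ((L * U) ^\<^sub>m n)"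
    unfolding totally_positive_def carrier_matD[OF pow_carrier_mat[OF LU, of n]] by blast
  moreover have "square_mat (L * U)"
    using L U by simp
  ultimately show ?thesis
    using \<open>n > 0\<close> by (auto simp: oscillatory_def)
qed


subsection \<open>Jacobi matrices\<close>

lemma jacobi_matrixD:
  assumes "jacobi_matrix J"
  shows "J n (Suc n) = 1" "J (Suc n) n > 0"
    "j \<noteq> i \<Longrightarrow> j \<noteq> Suc i \<Longrightarrow> i \<noteq> Suc j \<Longrightarrow> J i j = 0"
  using assms by (auto simp: jacobi_matrix_def)

text \<open>\<open>poly (continuant J n) t\<close> is the leading principal minor of order \<open>n\<close> of \<open>J + t I\<close>; superdiagonal
  entries are taken to be 1.\<close>

fun continuant :: "(nat \<Rightarrow> nat \<Rightarrow> real) \<Rightarrow> nat \<Rightarrow> real poly" where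
  "continuant J 0 = 1"
| "continuant J (Suc 0) = [:J 0 0, 1:]"
| "continuant J (Suc (Suc n)) =
     [:J (Suc n) (Suc n), 1:] * continuant J (Suc n) - Polynomial.smult (J (Suc n) n) (continuant J n)"

text \<open>The linear factor raises the degree by one and keeps the leading coefficient, while the
  subtracted term has smaller degree. Being monic makes the polynomial positive for large
  arguments.\<close>

lemma continuant_monic: "degree (continuant J n) = n \<and> lead_coeff (continuant J n) = 1"
proof (induction J n rule: continuant.induct)
  case (3 J n)
  let ?p = "[:J (Suc n) (Suc n), 1:] * continuant J (Suc n)"
  let ?q = "- Polynomial.smult (J (Suc n) n) (continuant J n)"
  have "continuant J (Suc n) \<noteq> 0" using 3 by auto
  then have "degree ?p = Suc (Suc n)"
    using 3 by (subst degree_mult_eq) auto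
  moreover have "lead_coeff ?p = 1"
    using conjunct2[OF 3(1)] by (simp only: lead_coeff_mult) simp
  moreover have "degree ?q < Suc (Suc n)"
    using 3 degree_smult_le[of "J (Suc n) n" "continuant J n"] by (simp del: degree_smult_eq)
  ultimately have "degree (?p + ?q) = Suc (Suc n)" "lead_coeff (?p + ?q) = 1"
    using degree_add_eq_left[of ?q ?p] lead_coeff_add_le[of ?q ?p] by (simp_all only: add.commute[of ?p ?q])
  then show ?case by simp
qed auto

text \<open>With alternating signs the continuant values form an eigenvector: their recurrence is,
  row by row, the equation \<open>(J + t I) x = 0\<close>. The first entry 1 makes the vector
  nonzero.\<close>

lemma eigenvalue_continuant_root:
  assumes J: "jacobi_matrix J" and root: "poly (continuant J (Suc N)) t = 0"
  shows "eigenvalue (leading_submatrix J N) (- t)"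
proof -
  define x where "x i = (- 1) ^ i * poly (continuant J i) t" for i
  define v where "v = vec (N + 1) x"
  let ?A = "leading_submatrix J N"
  have row: "(\<Sum>j\<in>{0..<N + 1}. J i j * x j) = - t * x i" if "i < N + 1" for i
  proof -
    have "x (Suc N) = 0" using root by (simp add: x_def)
    \<comment> \<open>Because \<open>x (Suc N)\<close> vanishes at the root, one more column can be
      added; the last row then has the same shape as the others.\<close>
    then have "(\<Sum>j\<in>{0..<N + 1}. J i j * x j) = (\<Sum>j\<in>{0..<N + 2}. J i j * x j)" by simp
    also have "\<dots> = - t * x i"
    proof (cases i)
      case 0
      have "(\<Sum>j\<in>{0..<N + 2}. J i j * x j) = (\<Sum>j\<in>{0, 1}. J i j * x j)"
        using jacobi_matrixD(3)[OF J] 0 by (intro sum.mono_neutral_right) auto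
      then show ?thesis
        using jacobi_matrixD(1)[OF J, of 0] 0 by (simp add: x_def algebra_simps)
    next
      case (Suc m)
      have "(\<Sum>j\<in>{0..<N + 2}. J i j * x j) = (\<Sum>j\<in>{m, Suc m, Suc (Suc m)}. J i j * x j)"
        using jacobi_matrixD(3)[OF J] Suc that by (intro sum.mono_neutral_right) auto
      then show ?thesis
        using jacobi_matrixD(1)[OF J, of "Suc m"] Suc by (simp add: x_def algebra_simps)
    qed
    finally show ?thesis .
  qed
  have "?A *\<^sub>v v = (- t) \<cdot>\<^sub>v v"
    using row by (auto intro!: eq_vecI simp: leading_submatrix_def v_def scalar_prod_def)
  moreover have "v $ 0 = 1" by (simp add: v_def x_def)
  then have "v \<noteq> 0\<^sub>v (N + 1)" by auto
  ultimately show ?thesis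
    unfolding eigenvalue_def eigenvector_def
    by (auto intro!: exI[of _ v] simp: leading_submatrix_def v_def)
qed

section \<open>Eigenvalue bounds and positivity of the continuants\<close>

lemma eigenvalue_abs_le_norm_inf:
  assumes fin: "norm_inf J < \<infinity>" and "eigenvalue (leading_submatrix J N) x"
  shows "\<bar>x\<bar> \<le> enn2real (norm_inf J)"
proof -
  let ?A = "leading_submatrix J N" and ?I = "{0..<N + 1}"
  obtain v where v: "v \<in> carrier_vec (N + 1)" "v \<noteq> 0\<^sub>v (N + 1)" "?A *\<^sub>v v = x \<cdot>\<^sub>v v"
    using assms(2) by (auto simp: eigenvalue_def eigenvector_def leading_submatrix_def)
  \<comment> \<open>In a row where the eigenvector has an entry of largest modulus, all entries can
    be estimated by that one, which then cancels.\<close>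
  obtain i where i: "i \<in> ?I" "\<And>j. j \<in> ?I \<Longrightarrow> \<bar>v $ j\<bar> \<le> \<bar>v $ i\<bar>"
  proof -
    have "Max ((\<lambda>j. \<bar>v $ j\<bar>) ` ?I) \<in> (\<lambda>j. \<bar>v $ j\<bar>) ` ?I"
      by (rule Max_in) auto
    then obtain i where "i \<in> ?I" "\<bar>v $ i\<bar> = Max ((\<lambda>j. \<bar>v $ j\<bar>) ` ?I)"
      by (metis (no_types, lifting) imageE)
    then show thesis using that by simp
  qed
  obtain j where "j < N + 1" "v $ j \<noteq> 0"
    using v(1,2) by (metis carrier_vecD eq_vecI index_zero_vec)
  then have pos: "\<bar>v $ i\<bar> > 0"
    using i(2)[of j] by simp
  have "(\<Sum>j\<in>?I. J i j * v $ j) = (?A *\<^sub>v v) $ i"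
    using i v(1) by (simp add: leading_submatrix_def scalar_prod_def)
  also have "\<dots> = x * v $ i"
    using i v(1) by (simp add: v(3))
  finally have "\<bar>x\<bar> * \<bar>v $ i\<bar> = \<bar>\<Sum>j\<in>?I. J i j * v $ j\<bar>"
    by (simp add: abs_mult)
  also have "\<dots> \<le> (\<Sum>j\<in>?I. \<bar>J i j\<bar> * \<bar>v $ i\<bar>)"
    using i(2) by (intro order.trans[OF sum_abs] sum_mono) (simp add: abs_mult mult_left_mono)
  also have "\<dots> = (\<Sum>j\<in>?I. \<bar>J i j\<bar>) * \<bar>v $ i\<bar>"
    by (rule sum_distrib_right[symmetric])
  finally have "\<bar>x\<bar> \<le> (\<Sum>j\<in>?I. \<bar>J i j\<bar>)"
    using pos by simp
  also have "ennreal (\<Sum>j\<in>?I. \<bar>J i j\<bar>) \<le> (\<Sum>j. ennreal \<bar>J i j\<bar>)"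
    by (subst sum_ennreal[symmetric], simp) (rule sum_le_suminf, simp_all del: sum.op_ivl_Suc)
  then have "ennreal (\<Sum>j\<in>?I. \<bar>J i j\<bar>) \<le> norm_inf J"
    unfolding norm_inf_def by (rule order.trans) (rule SUP_upper, simp)
  \<comment> \<open>\<open>enn2real\<close> sends infinity to 0, so the comparison of real values
    rests on the finiteness of the norm.\<close>
  then have "(\<Sum>j\<in>?I. \<bar>J i j\<bar>) \<le> enn2real (norm_inf J)"
    using fin by (metis enn2real_ennreal enn2real_mono infinity_ennreal_def sum_nonneg abs_ge_zero)
  finally show ?thesis .
qed

text \<open>A real \<open>Sup\<close> is an upper bound once the set is bounded above, which the
  norm estimate provides.\<close>

lemma abs_le_neg_eigenvalue_bound:
  assumes "norm_inf J < \<infinity>" and "x \<in> negative_eigenvalues J"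
  shows "\<bar>x\<bar> \<le> neg_eigenvalue_bound J"
proof -
  have "bdd_above (abs ` negative_eigenvalues J)"
    using eigenvalue_abs_le_norm_inf[OF assms(1)]
    by (intro bdd_aboveI2[of _ _ "enn2real (norm_inf J)"]) (unfold negative_eigenvalues_def, blast)
  then show ?thesis
    using assms(2) by (auto simp: neg_eigenvalue_bound_def intro: cSUP_upper)
qed

lemma neg_eigenvalue_bound_nonneg:
  assumes "norm_inf J < \<infinity>"
  shows "neg_eigenvalue_bound J \<ge> 0"
proof (cases "negative_eigenvalues J = {}")
  case False
  then show ?thesis
    using abs_le_neg_eigenvalue_bound[OF assms] by (meson abs_ge_zero all_not_in_conv order.trans)
qed (simp add: neg_eigenvalue_bound_def)

text \<open>A root \<open>u \<ge> t\<close> would give the negative eigenvalue \<open>- u\<close>,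
  of modulus beyond the bound. A monic polynomial without roots on the half-line from
  \<open>t\<close> is positive there, by the intermediate value theorem.\<close>

lemma continuant_pos_above_bound:
  assumes J: "jacobi_matrix J" and fin: "norm_inf J < \<infinity>" and t: "t > neg_eigenvalue_bound J"
  shows "poly (continuant J n) t > 0"
proof (cases n)
  case (Suc N)
  have nonzero: "poly (continuant J n) u \<noteq> 0" if "u \<ge> t" for u
  proof
    assume "poly (continuant J n) u = 0"
    then have "eigenvalue (leading_submatrix J N) (- u)"
      using eigenvalue_continuant_root[OF J] Suc by blast
    \<comment> \<open>Nonnegativity of the bound ensures that \<open>- u\<close> really is a
      negative eigenvalue.\<close>
    moreover have "u > 0"
      using neg_eigenvalue_bound_nonneg[OF fin] t that by linarith
    ultimately have "u \<le> neg_eigenvalue_bound J"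
      using abs_le_neg_eigenvalue_bound[OF fin, of "- u"] by (auto simp: negative_eigenvalues_def)
    then show False using t that by linarith
  qed
  obtain M where M: "\<And>u. u \<ge> M \<Longrightarrow> poly (continuant J n) u \<ge> 1"
    using poly_pinfty_gt_lc[of "continuant J n"]
    unfolding conjunct2[OF continuant_monic] by auto
  show ?thesis
  proof (rule ccontr)
    assume "\<not> poly (continuant J n) t > 0"
    then have "poly (continuant J n) t \<le> 0" by simp
    moreover have "poly (continuant J n) (max t M) \<ge> 0"
      using M[of "max t M"] by simp
    moreover have "continuous_on {t..max t M} (poly (continuant J n))"
      by (intro continuous_intros)
    ultimately obtain u where "t \<le> u" "poly (continuant J n) u = 0"
      using IVT'[of "poly (continuant J n)" t 0 "max t M"] by auto
    then show False using nonzero by blast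
  qed
qed simp

text \<open>The critical case is \<open>s\<close> equal to the bound: there the values are nonnegative by continuity,
  and a first zero would make the next value negative.\<close>

lemma continuant_pos:
  assumes J: "jacobi_matrix J" and fin: "norm_inf J < \<infinity>" and s: "s \<ge> neg_eigenvalue_bound J"
  shows "poly (continuant J n) s > 0"
proof -
  have nonneg: "poly (continuant J n) s \<ge> 0" for n
  proof (rule tendsto_lowerbound)
    show "(poly (continuant J n) \<longlongrightarrow> poly (continuant J n) s) (at_right s)"
      by (intro tendsto_intros)
    show "\<forall>\<^sub>F t in at_right s. poly (continuant J n) t \<ge> 0"
      using continuant_pos_above_bound[OF J fin] s
      by (auto simp: eventually_at_right_less intro!: eventually_mono[OF eventually_at_right_less[of s]] less_imp_le)
  qed simp
  show ?thesis
  proof (induction n)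
    case (Suc n)
    show ?case
    proof (rule ccontr)
      assume "\<not> poly (continuant J (Suc n)) s > 0"
      then have "poly (continuant J (Suc n)) s = 0"
        using nonneg[of "Suc n"] by linarith
      then have "poly (continuant J (Suc (Suc n))) s = - (J (Suc n) n * poly (continuant J n) s)"
        by simp
      then show False
        using nonneg[of "Suc (Suc n)"] mult_pos_pos[OF jacobi_matrixD(2)[OF J, of n] Suc] by linarith
    qed
  qed simp
qed

section \<open>Bidiagonal factorization of the shifted truncations\<close>

theorem theorem3:
  fixes J :: "nat \<Rightarrow> nat \<Rightarrow> real" and s :: real
  assumes "jacobi_matrix J"
    and "norm_inf J < \<infinity>"
    and "s \<ge> neg_eigenvalue_bound J"
  shows "oscillatory_semi_infinite (shift_matrix J s)"
  unfolding oscillatory_semi_infinite_def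
proof
  fix N :: nat
  let ?n = "N + 1"
  define d where "d k = poly (continuant J k) s" for k
  have d: "d k > 0" for k
    unfolding d_def by (rule continuant_pos[OF assms])
  note J = jacobi_matrixD[OF assms(1)]
  \<comment> \<open>These ratios of consecutive leading principal minors are the pivots of Gaussian
    elimination.\<close>
  define u where "u k = d (Suc k) / d k" for k
  have u: "u k > 0" for k
    by (simp add: u_def d)
  have d0: "d 0 = 1" "d (Suc 0) = J 0 0 + s"
    and dSuc: "d (Suc (Suc k)) = (J (Suc k) (Suc k) + s) * d (Suc k) - J (Suc k) k * d k" for k
    by (simp_all add: d_def distrib_right)
  have u0: "u 0 = J 0 0 + s"
    by (simp add: u_def d0)
  \<comment> \<open>This is the three-term recurrence divided by \<open>d (Suc k)\<close>; it
    matches the diagonal entries of \<open>L * U\<close>.\<close>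
  have uSuc: "J (Suc k) k / u k + u (Suc k) = J (Suc k) (Suc k) + s" for k
    using d[of k] d[of "Suc k"] by (simp add: u_def dSuc field_simps)
  \<comment> \<open>\<open>L\<close> carries the elimination multipliers and \<open>U\<close> the
    pivots; the superdiagonal of \<open>U\<close> is that of \<open>J\<close>, hence 1.\<close>
  define L where "L = mat ?n ?n (\<lambda>(i, j). if i = j then 1 else if i = Suc j then J i j / u j else 0)"
  define U where "U = mat ?n ?n (\<lambda>(i, j). if j = i then u i else if j = Suc i then 1 else 0)"
  have "leading_submatrix (shift_matrix J s) N = L * U"
  proof (rule eq_matI)
    fix i j assume "i < dim_row (L * U)" "j < dim_col (L * U)"
    then have ij: "i < ?n" "j < ?n" by (auto simp: L_def U_def)
    have "(L * U) $$ (i, j) = (\<Sum>c\<in>{0..<?n}. L $$ (i, c) * U $$ (c, j))"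
      using ij by (simp add: L_def U_def scalar_prod_def)
    also have "\<dots> = shift_matrix J s i j"
    proof (cases i)
      case 0
      have "(\<Sum>c\<in>{0..<?n}. L $$ (i, c) * U $$ (c, j)) = (\<Sum>c\<in>{0}. L $$ (i, c) * U $$ (c, j))"
        using 0 by (intro sum.mono_neutral_right) (auto simp: L_def)
      then show ?thesis
        using 0 ij J(1)[of 0] J(3)[of j 0] u0 by (auto simp: L_def U_def shift_matrix_def)
    next
      case (Suc k)
      \<comment> \<open>Row \<open>Suc k\<close> of \<open>L\<close> is supported on columns
        \<open>k\<close> and \<open>Suc k\<close>.\<close>
      have "(\<Sum>c\<in>{0..<?n}. L $$ (i, c) * U $$ (c, j)) = (\<Sum>c\<in>{k, Suc k}. L $$ (i, c) * U $$ (c, j))"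
        using Suc ij by (intro sum.mono_neutral_right) (auto simp: L_def)
      then show ?thesis
        using Suc ij J(1)[of "Suc k"] J(3)[of j "Suc k"] uSuc[of k] u[of k]
        by (auto simp: L_def U_def shift_matrix_def)
    qed
    finally show "leading_submatrix (shift_matrix J s) N $$ (i, j) = (L * U) $$ (i, j)"
      using ij by (simp add: leading_submatrix_def)
  qed (simp_all add: leading_submatrix_def L_def U_def)
  moreover have "oscillatory (L * U)"
    using u J(2) by (intro oscillatory_bidiagonal_product[of ?n]) (auto simp: L_def U_def)
  ultimately show "oscillatory (leading_submatrix (shift_matrix J s) N)" by simp
qed

end
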